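(* Assume that the family $(f_i)_{i=1}^N$ of contractive similitudes on $\mathbb{R}^q$, with contraction ratios $(s_i)_{i=1}^N$, satisfies the open set condition. Let $d_0$ be the unique positive real number satisfying $\sum_{i=1}^Ns_i^{d_0}=1$, and let $\nu$ be the self-similar measure associated with $(f_i)_{i=1}^N$ and the probability vector $(s_i^{d_0})_{i=1}^N$. Let $(p_i)_{i=0}^N$ be a probability vector with $p_i>0$ for all $0\leq i\leq N$, and let $\mu$ be the unique Borel probability measure satisfying $\mu=p_0\nu+\sum_{i=1}^Np_i\,\mu\circ f_i^{-1}$. Then for every $r>0$, the quantization dimension $D_r(\mu)$ exists and $$D_r(\mu)=d_0,\qquad 0<\underline{Q}_r^{d_0}(\mu)\leq\overline{Q}_r^{d_0}(\mu)<\infty.$$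
   Context: Throughout $N\geq 2$. A contractive similitude $f_i:\mathbb{R}^q\to\mathbb{R}^q$ with contraction ratio $s_i\in(0,1)$ satisfies $|f_i(x)-f_i(y)|=s_i|x-y|$ for all $x,y$. Open set condition (OSC): there is a non-empty open set $U\subset\mathbb{R}^q$ with $f_i(U)\subset U$ for all $i$ and $f_i(U)\cap f_j(U)=\emptyset$ for all $i\neq j$. The self-similar measure associated with $(f_i)_{i=1}^N$ and a probability vector $(t_i)_{i=1}^N$ is the unique Borel probability measure $\nu$ on $\mathbb{R}^q$ with $\nu=\sum_{i=1}^Nt_i\,\nu\circ f_i^{-1}$. For a Borel probability measure $P$ on $\mathbb{R}^q$, $r>0$ and $n\in\mathbb{N}$, the $n$th quantization error of order $r$ is $$e_{n,r}(P):=\inf_{\alpha\subset\mathbb{R}^q,\;1\leq{\rm card}(\alpha)\leq n}\Big(\int d(x,\alpha)^r\,dP(x)\Big)^{1/r},$$ where $d(x,\alpha)$ is the Euclidean distance from $x$ to $\alpha$. The upper and lower quantization dimensions of order $r$ are $$\overline{D}_r(P):=\limsup_{n\to\infty}\frac{\log n}{-\log e_{n,r}(P)},\qquad \underline{D}_r(P):=\liminf_{n\to\infty}\frac{\log n}{-\log e_{n,r}(P)};$$ if they coincide, the common value is called the quantization dimension $D_r(P)$ and $D_r(P)$ is said to exist. For $s>0$ the $s$-dimensional upper and lower quantization coefficients are $$\overline{Q}_r^s(P):=\limsup_{n\to\infty}n^{1/s}e_{n,r}(P),\qquad \underline{Q}_r^s(P):=\liminf_{n\to\infty}n^{1/s}e_{n,r}(P).$$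 *)

theory Defs
  imports "HOL-Probability.Probability"
begin

definition contractive_similitude :: "real \<Rightarrow> (real^'q \<Rightarrow> real^'q) \<Rightarrow> bool" where
  "contractive_similitude s f \<longleftrightarrow>
     0 < s \<and> s < 1 \<and> (\<forall>x y. dist (f x) (f y) = s * dist x y)"

definition open_set_condition :: "nat \<Rightarrow> (nat \<Rightarrow> real^'q \<Rightarrow> real^'q) \<Rightarrow> bool" where
  "open_set_condition N f \<longleftrightarrow>
     (\<exists>U. open U \<and> U \<noteq> {} \<and> (\<forall>i\<in>{1..N}. f i ` U \<subseteq> U) \<and>
          (\<forall>i\<in>{1..N}. \<forall>j\<in>{1..N}. i \<noteq> j \<longrightarrow> f i ` U \<inter> f j ` U = {}))"

definition borel_prob_measure :: "(real^'q) measure \<Rightarrow> bool" where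
  "borel_prob_measure P \<longleftrightarrow> prob_space P \<and> sets P = sets borel"

text \<open>
  The self-similar measure is the unique \<open>\<nu>\<close> satisfying the following predicate (uniqueness
  holds by the contraction principle whenever the maps are contractive similitudes and \<open>t\<close> is a
  probability vector), and likewise for the condensation measure \<open>\<mu>\<close> below.
\<close>

definition self_similar_measure ::
  "nat \<Rightarrow> (nat \<Rightarrow> real^'q \<Rightarrow> real^'q) \<Rightarrow> (nat \<Rightarrow> real) \<Rightarrow> (real^'q) measure \<Rightarrow> bool" where
  "self_similar_measure N f t \<nu> \<longleftrightarrow> borel_prob_measure \<nu> \<and>
     (\<forall>A\<in>sets borel. emeasure \<nu> A =
        (\<Sum>i=1..N. ennreal (t i) * emeasure (distr \<nu> borel (f i)) A))"

definition condensation_measure ::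
  "nat \<Rightarrow> (nat \<Rightarrow> real^'q \<Rightarrow> real^'q) \<Rightarrow> (nat \<Rightarrow> real) \<Rightarrow> (real^'q) measure
    \<Rightarrow> (real^'q) measure \<Rightarrow> bool" where
  "condensation_measure N f p \<nu> \<mu> \<longleftrightarrow> borel_prob_measure \<mu> \<and>
     (\<forall>A\<in>sets borel. emeasure \<mu> A = ennreal (p 0) * emeasure \<nu> A +
        (\<Sum>i=1..N. ennreal (p i) * emeasure (distr \<mu> borel (f i)) A))"

text \<open>
  The quantization error is infinite when \<open>P\<close> has no finite moment of order \<open>r\<close>, so powers and
  logarithms are extended to infinity, with \<open>log 0 = -\<infinity>\<close>.
\<close>

definition ennpowr :: "ennreal \<Rightarrow> real \<Rightarrow> ennreal" where
  "ennpowr x a = (if x = \<top> then \<top> else ennreal (enn2real x powr a))"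

definition ennln :: "ennreal \<Rightarrow> ereal" where
  "ennln x = (if x = 0 then -\<infinity> else if x = \<top> then \<infinity> else ereal (ln (enn2real x)))"

definition quantization_error :: "nat \<Rightarrow> real \<Rightarrow> (real^'q) measure \<Rightarrow> ennreal" where
  "quantization_error n r P =
     (INF \<alpha>\<in>{\<alpha>. finite \<alpha> \<and> 1 \<le> card \<alpha> \<and> card \<alpha> \<le> n}.
        ennpowr (\<integral>\<^sup>+x. ennreal (infdist x \<alpha> powr r) \<partial>P) (1 / r))"

definition upper_quantization_dim :: "real \<Rightarrow> (real^'q) measure \<Rightarrow> ereal" where
  "upper_quantization_dim r P =
     limsup (\<lambda>n. ereal (ln (real n)) / (- ennln (quantization_error n r P)))"

definition lower_quantization_dim :: "real \<Rightarrow> (real^'q) measure \<Rightarrow> ereal" where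
  "lower_quantization_dim r P =
     liminf (\<lambda>n. ereal (ln (real n)) / (- ennln (quantization_error n r P)))"

text \<open>The quantization dimension of order \<open>r\<close> exists and equals \<open>d\<close>.\<close>

definition has_quantization_dim :: "real \<Rightarrow> (real^'q) measure \<Rightarrow> ereal \<Rightarrow> bool" where
  "has_quantization_dim r P d \<longleftrightarrow>
     lower_quantization_dim r P = d \<and> upper_quantization_dim r P = d"

definition upper_quantization_coeff :: "real \<Rightarrow> real \<Rightarrow> (real^'q) measure \<Rightarrow> ennreal" where
  "upper_quantization_coeff r s P =
     limsup (\<lambda>n. ennreal (real n powr (1 / s)) * quantization_error n r P)"

definition lower_quantization_coeff :: "real \<Rightarrow> real \<Rightarrow> (real^'q) measure \<Rightarrow> ennreal" where
  "lower_quantization_coeff r s P =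
     liminf (\<lambda>n. ennreal (real n powr (1 / s)) * quantization_error n r P)"

end

theory Submission
  imports Defs "HOL-Real_Asymp.Real_Asymp"
begin

text \<open>
  The support of \<open>\<mu>\<close> is contained in that of \<open>\<nu>\<close>: if \<open>V\<close> is the union of all open \<open>\<nu>\<close>-null sets,
  then \<open>f\<^sub>i\<close>-preimages of \<open>V\<close> lie in \<open>V\<close>, so \<open>\<mu>(V) \<le> (1 - p\<^sub>0) \<mu>(V)\<close> and hence \<open>\<mu>(V) = 0\<close>.
  For the upper bound, cut the word tree where the contraction ratio drops to about \<open>\<epsilon>\<close>; the
  weights \<open>s\<^sub>w powr d\<^sub>0\<close> of the cut sum to 1, so it has \<open>O(1 / \<epsilon> powr d\<^sub>0)\<close> words, and one point per
  word is within \<open>O(\<epsilon>)\<close> of the whole support of \<open>\<nu>\<close>. For the lower bound, \<open>\<mu> \<ge> p\<^sub>0 \<nu>\<close>, and the open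
  set condition bounds the number of pieces of the cut meeting a ball of radius \<open>\<epsilon>\<close> by a volume
  comparison, so \<open>\<nu>\<close> of that ball is \<open>O(\<epsilon> powr d\<^sub>0)\<close>: \<open>n\<close> balls of radius \<open>c / n powr (1 / d\<^sub>0)\<close>
  miss half of the mass of \<open>\<nu>\<close>.
\<close>

section \<open>Similitudes, volumes of disjoint balls, and open null sets\<close>

lemma contractive_similitude_continuous:
  assumes "contractive_similitude s f"
  shows "continuous_on A f"
proof -
  have "s-lipschitz_on UNIV f"
    using assms by (intro lipschitz_onI) (auto simp: contractive_similitude_def)
  then show ?thesis
    using lipschitz_on_continuous_on continuous_on_subset by blast
qed

lemma contractive_similitude_measurable:
  "contractive_similitude s f \<Longrightarrow> f \<in> borel_measurable borel"
  by (simp add: borel_measurable_continuous_onI contractive_similitude_continuous)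

text \<open>The inclusion from right to left needs surjectivity, which follows from finite
  dimension: rescaling and translating \<open>f\<close> gives an isometry fixing 0, hence an
  orthogonal linear map.\<close>

lemma similitude_image_ball:
  fixes f :: "real^'q \<Rightarrow> real^'q"
  assumes "0 < s" and f: "\<And>x y. dist (f x) (f y) = s * dist x y"
  shows "f ` ball a \<rho> = ball (f a) (s * \<rho>)"
proof
  show "f ` ball a \<rho> \<subseteq> ball (f a) (s * \<rho>)"
    using assms by auto
  define g where "g x = (1 / s) *\<^sub>R (f x - f 0)" for x
  have "dist (g x) (g y) = dist x y" for x y
  proof -
    have "g x - g y = (1 / s) *\<^sub>R (f x - f y)"
      by (simp add: g_def algebra_simps)
    then show ?thesis
      using f[of x y] \<open>0 < s\<close> by (simp add: dist_norm)
  qed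
  then have "orthogonal_transformation g"
    by (simp add: orthogonal_transformation_isometry g_def)
  then have g: "surj g"
    by (rule orthogonal_transformation_surj)
  show "ball (f a) (s * \<rho>) \<subseteq> f ` ball a \<rho>"
  proof
    fix y assume y: "y \<in> ball (f a) (s * \<rho>)"
    obtain x where "(1 / s) *\<^sub>R (y - f 0) = g x"
      using g by (metis surjD)
    then have "f x = y"
      using \<open>0 < s\<close> by (simp add: g_def)
    then show "y \<in> f ` ball a \<rho>"
      using y f[of a x] \<open>0 < s\<close> by auto
  qed
qed

text \<open>Lebesgue volumes of the disjoint small balls add up to at most that of the large ball,
  and the positive volume of the unit ball cancels.\<close>

lemma disjoint_balls_card_le:
  fixes c :: "'i \<Rightarrow> 'a::euclidean_space"
  assumes "finite I" "0 \<le> \<rho>" "0 \<le> L"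
    and disj: "disjoint_family_on (\<lambda>i. ball (c i) \<rho>) I"
    and sub: "\<And>i. i \<in> I \<Longrightarrow> ball (c i) \<rho> \<subseteq> ball x L"
  shows "real (card I) * \<rho> ^ DIM('a) \<le> L ^ DIM('a)"
proof -
  let ?v = "measure lborel (ball (0::'a) 1)"
  have "(\<Sum>i\<in>I. measure lborel (ball (c i) \<rho>)) = measure lborel (\<Union>i\<in>I. ball (c i) \<rho>)"
    using assms emeasure_lborel_ball_finite by (intro measure_finite_Union[symmetric]) (auto simp: less_top)
  also have "\<dots> \<le> measure lborel (ball x L)"
    using sub by (intro measure_mono_fmeasurable) (auto intro!: sets.finite_UN \<open>finite I\<close> simp: fmeasurable_def emeasure_lborel_ball_finite[simplified])
  finally have "real (card I) * (\<rho> ^ DIM('a) * ?v) \<le> L ^ DIM('a) * ?v"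
    using assms by (simp add: content_ball_conv_unit_ball[of \<rho>] content_ball_conv_unit_ball[of L])
  moreover have "?v > 0"
    by (rule content_ball_pos) simp
  ultimately show ?thesis
    by (simp add: mult.assoc[symmetric])
qed

text \<open>Second countability (Lindelof) replaces the union by a countable one.\<close>

lemma Union_open_null_sets:
  fixes M :: "'a::second_countable_topology measure"
  assumes "sets M = sets borel"
  shows "\<Union>{W. open W \<and> W \<in> null_sets M} \<in> null_sets M"
proof -
  obtain F where "F \<subseteq> {W. open W \<and> W \<in> null_sets M}" "countable F"
    "\<Union>F = \<Union>{W. open W \<and> W \<in> null_sets M}"
    using Lindelof[of "{W. open W \<and> W \<in> null_sets M}"] by auto
  then show ?thesis
    using null_sets_UN'[of F "\<lambda>W. W" M] by auto
qed

section \<open>From bounds of order \<open>n powr (- 1 / d)\<close> to quantization coefficients and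
  dimension\<close>

lemma ennpowr_mono:
  assumes "x \<le> y" "0 \<le> a"
  shows "ennpowr x a \<le> ennpowr y a"
  using assms
  by (auto simp: ennpowr_def top_unique less_top intro!: ennreal_leI powr_mono2 enn2real_mono)

lemma quantization_coeff_of_bounds:
  assumes "0 < c"
    and lower: "\<And>n. 1 \<le> n \<Longrightarrow> ennreal (c * real n powr (- 1 / d)) \<le> quantization_error n r P"
    and upper: "\<And>n. 1 \<le> n \<Longrightarrow> quantization_error n r P \<le> ennreal (C * real n powr (- 1 / d))"
  shows "0 < lower_quantization_coeff r d P \<and>
    lower_quantization_coeff r d P \<le> upper_quantization_coeff r d P \<and>
    upper_quantization_coeff r d P < \<infinity>"
proof (intro conjI)
  \<comment> \<open>Only the first factor must be nonnegative for \<open>ennreal\<close> to be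
    multiplicative here, so one identity serves both \<open>c\<close> and \<open>C\<close>.\<close>
  have scale: "ennreal (real n powr (1 / d)) * ennreal (K * real n powr (- 1 / d)) = ennreal K"
    if "1 \<le> n" for n K
  proof -
    have "real n powr (1 / d) * (K * real n powr (- 1 / d)) = K"
      using that by (simp add: powr_minus_divide)
    then show ?thesis
      by (simp only: ennreal_mult'[symmetric] powr_ge_zero)
  qed
  have "ennreal c \<le> lower_quantization_coeff r d P"
    unfolding lower_quantization_coeff_def
  proof (rule Liminf_bounded, rule eventually_sequentiallyI[of 1])
    fix n :: nat assume n: "1 \<le> n"
    show "ennreal c \<le> ennreal (real n powr (1 / d)) * quantization_error n r P"
      using mult_left_mono[OF lower[OF n], of "ennreal (real n powr (1 / d))"] scale[OF n, of c] by simp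
  qed
  then show "0 < lower_quantization_coeff r d P"
    using \<open>0 < c\<close> by (auto simp: less_le_trans[of 0 "ennreal c"])
  show "lower_quantization_coeff r d P \<le> upper_quantization_coeff r d P"
    unfolding lower_quantization_coeff_def upper_quantization_coeff_def
    by (rule Liminf_le_Limsup) simp
  have "upper_quantization_coeff r d P \<le> ennreal C"
    unfolding upper_quantization_coeff_def
  proof (rule Limsup_bounded, rule eventually_sequentiallyI[of 1])
    fix n :: nat assume n: "1 \<le> n"
    show "ennreal (real n powr (1 / d)) * quantization_error n r P \<le> ennreal C"
      using mult_left_mono[OF upper[OF n], of "ennreal (real n powr (1 / d))"] scale[OF n, of C] by simp
  qed
  then show "upper_quantization_coeff r d P < \<infinity>"
    using le_less_trans[OF _ ennreal_less_top] by (auto simp: infinity_ennreal_def)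
qed

text \<open>Taking logarithms, \<open>- ln (e n)\<close> differs from \<open>ln (real n) / d\<close>
  by a bounded amount, which disappears in the quotient with \<open>ln (real n)\<close>.\<close>

lemma has_quantization_dim_of_bounds:
  assumes "0 < d" "0 < c"
    and lower: "\<And>n. 1 \<le> n \<Longrightarrow> ennreal (c * real n powr (- 1 / d)) \<le> quantization_error n r P"
    and upper: "\<And>n. 1 \<le> n \<Longrightarrow> quantization_error n r P \<le> ennreal (C * real n powr (- 1 / d))"
  shows "has_quantization_dim r P (ereal d)"
proof -
  define e where "e n = enn2real (quantization_error n r P)" for n
  have e_eq: "quantization_error n r P = ennreal (e n)" if "1 \<le> n" for n
    unfolding e_def
    by (rule ennreal_enn2real[symmetric]) (rule le_less_trans[OF upper[OF that] ennreal_less_top])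
  have e_lower: "c * real n powr (- 1 / d) \<le> e n" if "1 \<le> n" for n
    using lower[OF that] unfolding e_eq[OF that] by (simp add: e_def)
  have e_pos: "0 < e n" if "1 \<le> n" for n
  proof -
    have "0 < c * real n powr (- 1 / d)"
      using \<open>0 < c\<close> that by simp
    then show ?thesis
      using e_lower[OF that] by linarith
  qed
  have e_upper: "e n \<le> C * real n powr (- 1 / d)" if "1 \<le> n" for n
  proof -
    have "ennreal (e n) \<le> ennreal (C * real n powr (- 1 / d))"
      using upper[OF that] e_eq[OF that] by simp
    then show ?thesis
      using e_pos[OF that] by (meson ennreal_le_iff2 not_le)
  qed
  have "0 < C"
    using e_pos[of 1] e_upper[of 1] by simp
  have ln_powr_bound: "ln (K * real n powr (- 1 / d)) = ln K - ln (real n) / d" if "0 < K" "1 \<le> n" for K n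
    using that by (simp add: ln_mult ln_powr)
  have ln_e: "ln (real n) / d - ln C \<le> - ln (e n)" "- ln (e n) \<le> ln (real n) / d - ln c"
    if n: "1 \<le> n" for n
  proof -
    have "ln (e n) \<le> ln (C * real n powr (- 1 / d))"
      using e_upper[OF n] e_pos[OF n] by (subst ln_le_cancel_iff) auto
    then show "ln (real n) / d - ln C \<le> - ln (e n)"
      using ln_powr_bound[OF \<open>0 < C\<close> n] by simp
    have "ln (c * real n powr (- 1 / d)) \<le> ln (e n)"
      using e_lower[OF n] e_pos[OF n] \<open>0 < c\<close> n by (subst ln_le_cancel_iff) auto
    then show "- ln (e n) \<le> ln (real n) / d - ln c"
      using ln_powr_bound[OF \<open>0 < c\<close> n] by simp
  qed
  \<comment> \<open>This makes all three denominators of the sandwich positive for large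
    \<open>n\<close>, since the other two are at least as large.\<close>
  have ev_pos: "\<forall>\<^sub>F n in sequentially. 0 < ln (real n) / d - ln C"
    using \<open>0 < d\<close> by real_asymp
  have lim: "(\<lambda>n. ln (real n) / (ln (real n) / d - K)) \<longlonglongrightarrow> d" for K
    using \<open>0 < d\<close> by real_asymp
  have "(\<lambda>n. ln (real n) / (- ln (e n))) \<longlonglongrightarrow> d"
  proof (rule tendsto_sandwich[OF _ _ lim[of "ln c"] lim[of "ln C"]])
    show "\<forall>\<^sub>F n in sequentially. ln (real n) / (ln (real n) / d - ln c) \<le> ln (real n) / (- ln (e n))"
      using ev_pos eventually_ge_at_top[of 1]
    proof eventually_elim
      case (elim n)
      then have "0 \<le> ln (real n)" by simp
      then show ?case
        using elim(1) ln_e[OF elim(2)] by (intro divide_left_mono mult_pos_pos) linarith+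
    qed
    show "\<forall>\<^sub>F n in sequentially. ln (real n) / (- ln (e n)) \<le> ln (real n) / (ln (real n) / d - ln C)"
      using ev_pos eventually_ge_at_top[of 1]
    proof eventually_elim
      case (elim n)
      then have "0 \<le> ln (real n)" by simp
      then show ?case
        using elim(1) ln_e[OF elim(2)] by (intro divide_left_mono mult_pos_pos) linarith+
    qed
  qed
  then have "(\<lambda>n. ereal (ln (real n) / (- ln (e n)))) \<longlonglongrightarrow> ereal d"
    by simp
  \<comment> \<open>Division by 0 has different values in the reals and in \<open>ereal\<close>, so
    the quotients are identified only where \<open>- ln (e n)\<close> is positive.\<close>
  moreover have "\<forall>\<^sub>F n in sequentially. ereal (ln (real n) / (- ln (e n)))
      = ereal (ln (real n)) / (- ennln (quantization_error n r P))"
    using ev_pos eventually_ge_at_top[of 1]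
  proof eventually_elim
    case (elim n)
    have "- ln (e n) > 0"
      using ln_e(1)[of n] elim by linarith
    moreover have "ennln (quantization_error n r P) = ereal (ln (e n))"
      using e_eq[of n] e_pos[of n] elim by (simp add: ennln_def)
    ultimately show ?case
      by simp
  qed
  ultimately have "(\<lambda>n. ereal (ln (real n)) / (- ennln (quantization_error n r P))) \<longlonglongrightarrow> ereal d"
    by (rule Lim_transform_eventually)
  then show ?thesis
    unfolding has_quantization_dim_def lower_quantization_dim_def upper_quantization_dim_def
    by (intro conjI lim_imp_Liminf lim_imp_Limsup) simp_all
qed

section \<open>Words, their maps and ratios, and the self-similarity of \<open>\<nu>\<close>\<close>

primrec word_map :: "(nat \<Rightarrow> 'a \<Rightarrow> 'a) \<Rightarrow> nat list \<Rightarrow> 'a \<Rightarrow> 'a" where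
  "word_map f [] = id"
| "word_map f (i # w) = f i \<circ> word_map f w"

primrec word_ratio :: "(nat \<Rightarrow> real) \<Rightarrow> nat list \<Rightarrow> real" where
  "word_ratio s [] = 1"
| "word_ratio s (i # w) = s i * word_ratio s w"

lemma word_map_subset:
  assumes "set w \<subseteq> I" "\<And>i. i \<in> I \<Longrightarrow> f i ` U \<subseteq> U"
  shows "word_map f w ` U \<subseteq> U"
  using assms(1)
proof (induction w)
  case (Cons i w)
  then show ?case
    using assms(2)[of i] by (auto simp: image_subset_iff)
qed simp

locale natural_self_similar =
  fixes N :: nat and f :: "nat \<Rightarrow> real^'q \<Rightarrow> real^'q" and s :: "nat \<Rightarrow> real"
    and d :: real and \<nu> :: "(real^'q) measure"
  assumes similitude: "i \<in> {1..N} \<Longrightarrow> contractive_similitude (s i) (f i)"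
    and d_pos: "0 < d" and sum_ratio: "(\<Sum>i=1..N. s i powr d) = 1"
    and self_similar: "self_similar_measure N f (\<lambda>i. s i powr d) \<nu>"
begin

lemma N_pos: "1 \<le> N"
  using sum_ratio by (cases N) auto

lemma dist_f: "i \<in> {1..N} \<Longrightarrow> dist (f i x) (f i y) = s i * dist x y"
  and s_pos: "i \<in> {1..N} \<Longrightarrow> 0 < s i"
  and s_less_1: "i \<in> {1..N} \<Longrightarrow> s i < 1"
  using similitude unfolding contractive_similitude_def by auto

lemma f_measurable: "i \<in> {1..N} \<Longrightarrow> f i \<in> borel_measurable borel"
  using similitude contractive_similitude_measurable by blast

lemma f_vimage_borel: "i \<in> {1..N} \<Longrightarrow> A \<in> sets borel \<Longrightarrow> f i -` A \<in> sets borel"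
  using measurable_sets[OF f_measurable, of i A] by simp

lemma word_dist:
  "set w \<subseteq> {1..N} \<Longrightarrow> dist (word_map f w x) (word_map f w y) = word_ratio s w * dist x y"
  by (induction w) (simp_all add: dist_f del: atLeastAtMost_iff)

lemma word_ratio_pos: "set w \<subseteq> {1..N} \<Longrightarrow> 0 < word_ratio s w"
  by (induction w) (simp_all add: s_pos del: atLeastAtMost_iff)

lemma word_continuous: "set w \<subseteq> {1..N} \<Longrightarrow> continuous_on A (word_map f w)"
proof (induction w arbitrary: A)
  case (Cons i w)
  then have "continuous_on A (word_map f w)" "continuous_on (word_map f w ` A) (f i)"
    using contractive_similitude_continuous[OF similitude[of i]] by auto
  then show ?case
    unfolding word_map.simps by (rule continuous_on_compose)
qed simp

lemma prob_space_nu: "prob_space \<nu>"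
  and sets_nu: "sets \<nu> = sets borel"
  using self_similar by (auto simp: self_similar_measure_def borel_prob_measure_def)

sublocale nu: prob_space \<nu>
  by (rule prob_space_nu)

lemma space_nu: "space \<nu> = UNIV"
  using sets_eq_imp_space_eq[OF sets_nu] by simp

lemma measure_nu:
  assumes "A \<in> sets borel"
  shows "measure \<nu> A = (\<Sum>i=1..N. s i powr d * measure \<nu> (f i -` A))"
proof -
  have "emeasure \<nu> A = (\<Sum>i=1..N. ennreal (s i powr d) * emeasure (distr \<nu> borel (f i)) A)"
    using self_similar assms by (auto simp: self_similar_measure_def)
  also have "\<dots> = (\<Sum>i=1..N. ennreal (s i powr d * measure \<nu> (f i -` A)))"
  proof (rule sum.cong[OF refl])
    fix i assume i: "i \<in> {1..N}"
    have "emeasure (distr \<nu> borel (f i)) A = emeasure \<nu> (f i -` A)"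
      using assms f_measurable[OF i] by (subst emeasure_distr) (auto simp: space_nu sets_nu cong: measurable_cong_sets)
    then show "ennreal (s i powr d) * emeasure (distr \<nu> borel (f i)) A
        = ennreal (s i powr d * measure \<nu> (f i -` A))"
      by (simp add: nu.emeasure_eq_measure ennreal_mult)
  qed
  also have "\<dots> = ennreal (\<Sum>i=1..N. s i powr d * measure \<nu> (f i -` A))"
    by (rule sum_ennreal) auto
  finally show ?thesis
    by (simp add: nu.emeasure_eq_measure sum_nonneg)
qed

section \<open>Cuts of the word tree at a given scale\<close>

definition smin :: real where "smin = Min (s ` {1..N})"
text \<open>One more letter multiplies a ratio by at least \<open>smin\<close>, which fixes the
  window \<open>[smin * \<epsilon>, \<epsilon>]\<close> for cut words; that \<open>smax\<close> is
  below 1 makes the recursion for cuts terminate.\<close>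

definition smax :: real where "smax = Max (s ` {1..N})"

lemma smin_le: "i \<in> {1..N} \<Longrightarrow> smin \<le> s i"
  and smax_ge: "i \<in> {1..N} \<Longrightarrow> s i \<le> smax"
  by (simp_all add: smin_def smax_def)

lemma smin_pos: "0 < smin"
  using N_pos s_pos by (auto simp: smin_def)

lemma smax_less_1: "smax < 1"
  using N_pos s_less_1 by (auto simp: smax_def)

lemma smin_le_smax: "smin \<le> smax"
  using smin_le[of 1] smax_ge[of 1] N_pos by auto

text \<open>
  Disjointness is stated for all sets \<open>U\<close> as in the open set condition, because the recursion that
  builds cuts does not depend on \<open>U\<close>.
\<close>

definition is_cut :: "real \<Rightarrow> nat list set \<Rightarrow> bool" where
  "is_cut \<epsilon> \<Gamma> \<longleftrightarrow> finite \<Gamma> \<and>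
     (\<forall>w\<in>\<Gamma>. set w \<subseteq> {1..N} \<and> smin * \<epsilon> \<le> word_ratio s w \<and> word_ratio s w \<le> \<epsilon>) \<and>
     (\<Sum>w\<in>\<Gamma>. word_ratio s w powr d) = 1 \<and>
     (\<forall>A\<in>sets borel. measure \<nu> A =
        (\<Sum>w\<in>\<Gamma>. word_ratio s w powr d * measure \<nu> (word_map f w -` A))) \<and>
     (\<forall>U. (\<forall>i\<in>{1..N}. f i ` U \<subseteq> U) \<and>
          (\<forall>i\<in>{1..N}. \<forall>j\<in>{1..N}. i \<noteq> j \<longrightarrow> f i ` U \<inter> f j ` U = {}) \<longrightarrow>
        disjoint_family_on (\<lambda>w. word_map f w ` U) \<Gamma>)"

lemma f_inj: "i \<in> {1..N} \<Longrightarrow> inj (f i)"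
  by (rule injI) (metis dist_f dist_eq_0_iff mult_eq_0_iff s_pos less_irrefl)

text \<open>Base of the recursion: the two bounds on \<open>\<epsilon>\<close> say that the ratio 1
  of the empty word lies in the window.\<close>

lemma is_cut_Nil: "1 \<le> \<epsilon> \<Longrightarrow> \<epsilon> \<le> 1 / smin \<Longrightarrow> is_cut \<epsilon> {[]}"
  using smin_pos by (simp add: is_cut_def disjoint_family_on_def field_simps)

text \<open>Prepending \<open>i\<close> multiplies ratios by \<open>s i\<close>, so a cut at scale
  \<open>\<epsilon> / s i\<close> becomes the branch at \<open>i\<close> of a cut at scale
  \<open>\<epsilon>\<close>. One application of \<open>sum_ratio\<close> and
  \<open>measure_nu\<close> at the root joins the branch identities.\<close>

lemma is_cut_prepend:
  assumes cut: "\<And>i. i \<in> {1..N} \<Longrightarrow> is_cut (\<epsilon> / s i) (\<Gamma> i)"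
  shows "is_cut \<epsilon> (\<Union>i\<in>{1..N}. (#) i ` \<Gamma> i)"
proof -
  have fin: "finite (\<Gamma> i)"
    and words: "\<And>w. w \<in> \<Gamma> i \<Longrightarrow> set w \<subseteq> {1..N}"
    and sum1: "(\<Sum>w\<in>\<Gamma> i. word_ratio s w powr d) = 1"
    and meas: "\<And>A. A \<in> sets borel \<Longrightarrow> measure \<nu> A =
        (\<Sum>w\<in>\<Gamma> i. word_ratio s w powr d * measure \<nu> (word_map f w -` A))"
    if "i \<in> {1..N}" for i
    using cut[OF that] unfolding is_cut_def by blast+
  have bounds: "smin * \<epsilon> \<le> s i * word_ratio s w \<and> s i * word_ratio s w \<le> \<epsilon>"
    if "i \<in> {1..N}" "w \<in> \<Gamma> i" for i w
  proof -
    have "smin * (\<epsilon> / s i) \<le> word_ratio s w \<and> word_ratio s w \<le> \<epsilon> / s i"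
      using cut[OF that(1)] that(2) unfolding is_cut_def by blast
    then show ?thesis
      using s_pos[OF that(1)] by (simp add: field_simps)
  qed
  have sum_prepend: "sum g (\<Union>i\<in>{1..N}. (#) i ` \<Gamma> i) = (\<Sum>i=1..N. \<Sum>w\<in>\<Gamma> i. g (i # w))"
    for g :: "nat list \<Rightarrow> real"
    using fin by (subst sum.UNION_disjoint) (auto simp: sum.reindex)
  have powr_prepend: "word_ratio s (i # w) powr d = s i powr d * word_ratio s w powr d"
    if "i \<in> {1..N}" "w \<in> \<Gamma> i" for i w
    using s_pos[OF that(1)] word_ratio_pos[OF words[OF that]] by (simp add: powr_mult)
  have "(\<Sum>i=1..N. \<Sum>w\<in>\<Gamma> i. word_ratio s (i # w) powr d)
      = (\<Sum>i=1..N. s i powr d * (\<Sum>w\<in>\<Gamma> i. word_ratio s w powr d))"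
    unfolding sum_distrib_left
    by (intro sum.cong refl) (simp add: powr_prepend del: word_ratio.simps)
  also have "\<dots> = (\<Sum>i=1..N. s i powr d)"
    by (intro sum.cong refl) (simp add: sum1)
  also have "\<dots> = 1"
    by (rule sum_ratio)
  finally have A: "(\<Sum>i=1..N. \<Sum>w\<in>\<Gamma> i. word_ratio s (i # w) powr d) = 1" .
  have B: "measure \<nu> A =
      (\<Sum>i=1..N. \<Sum>w\<in>\<Gamma> i. word_ratio s (i # w) powr d * measure \<nu> (word_map f (i # w) -` A))"
    if "A \<in> sets borel" for A
  proof -
    have "measure \<nu> A = (\<Sum>i=1..N. s i powr d * measure \<nu> (f i -` A))"
      by (rule measure_nu[OF that])
    also have "\<dots> = (\<Sum>i=1..N. s i powr d *
        (\<Sum>w\<in>\<Gamma> i. word_ratio s w powr d * measure \<nu> (word_map f w -` f i -` A)))"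
      by (intro sum.cong refl arg_cong2[where f = "(*)"] meas f_vimage_borel that)
    also have "\<dots> = (\<Sum>i=1..N. \<Sum>w\<in>\<Gamma> i.
        word_ratio s (i # w) powr d * measure \<nu> (word_map f (i # w) -` A))"
      unfolding sum_distrib_left
      by (intro sum.cong refl) (simp add: powr_prepend vimage_comp mult.assoc del: word_ratio.simps)
    finally show ?thesis .
  qed
  have C: "disjoint_family_on (\<lambda>w. word_map f w ` U) (\<Union>i\<in>{1..N}. (#) i ` \<Gamma> i)"
    if U: "\<forall>i\<in>{1..N}. f i ` U \<subseteq> U"
      "\<forall>i\<in>{1..N}. \<forall>j\<in>{1..N}. i \<noteq> j \<longrightarrow> f i ` U \<inter> f j ` U = {}" for U
    unfolding disjoint_family_on_def
  proof (intro ballI impI)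
    fix u v assume "u \<in> (\<Union>i\<in>{1..N}. (#) i ` \<Gamma> i)" "v \<in> (\<Union>i\<in>{1..N}. (#) i ` \<Gamma> i)" "u \<noteq> v"
    then obtain i j u' v' where uv: "u = i # u'" "v = j # v'" "i \<in> {1..N}" "j \<in> {1..N}"
      "u' \<in> \<Gamma> i" "v' \<in> \<Gamma> j" by blast
    \<comment> \<open>Tails map \<open>U\<close> into itself, so different first letters are
      separated by their own images of \<open>U\<close>. For equal first letters the tails differ,
      and injectivity of \<open>f i\<close> preserves their disjointness.\<close>
    have sub: "word_map f u' ` U \<subseteq> U" "word_map f v' ` U \<subseteq> U"
      using word_map_subset[of _ "{1..N}" f U] words uv U(1) by blast+
    show "word_map f u ` U \<inter> word_map f v ` U = {}"
    proof (cases "i = j")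
      case True
      have "disjoint_family_on (\<lambda>w. word_map f w ` U) (\<Gamma> i)"
        using cut[OF uv(3)] U unfolding is_cut_def by blast
      then have "word_map f u' ` U \<inter> word_map f v' ` U = {}"
        using uv True \<open>u \<noteq> v\<close> by (auto simp: disjoint_family_on_def)
      then show ?thesis
        using uv(1,2) True image_Int[OF f_inj[OF uv(3)], of "word_map f u' ` U" "word_map f v' ` U"]
        by (simp add: image_comp)
    next
      case False
      then have "f i ` U \<inter> f j ` U = {}"
        using U(2) uv by blast
      then show ?thesis
        using sub uv(1,2) by (auto simp: image_subset_iff)
    qed
  qed
  show ?thesis
    unfolding is_cut_def sum_prepend using fin words bounds A B C
    by (auto simp del: word_map.simps)
qed

text \<open>Induction on \<open>k\<close> with \<open>smax ^ k < \<epsilon>\<close>: from 1 upwards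
  the empty word is a cut, and below 1 the scales \<open>\<epsilon> / s i\<close> of the branches
  satisfy the inequality with \<open>k\<close> lowered by one.\<close>

lemma is_cut_exists:
  assumes "0 < \<epsilon>" "\<epsilon> \<le> 1 / smin"
  shows "\<exists>\<Gamma>. is_cut \<epsilon> \<Gamma>"
proof -
  have "smax > 0"
    using smin_pos smin_le_smax by linarith
  obtain k where "smax ^ k < \<epsilon>"
    using real_arch_pow_inv[OF assms(1) smax_less_1] by blast
  then show ?thesis
    using assms
  proof (induction k arbitrary: \<epsilon>)
    case 0
    then show ?case
      using is_cut_Nil[of \<epsilon>] by auto
  next
    case (Suc k)
    show ?case
    proof (cases "1 \<le> \<epsilon>")
      case True
      then show ?thesis
        using is_cut_Nil Suc.prems by blast
    next
      case False
      have "\<exists>\<Gamma>. is_cut (\<epsilon> / s i) \<Gamma>" if i: "i \<in> {1..N}" for i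
      proof (rule Suc.IH)
        have "smax ^ k * s i \<le> smax ^ k * smax"
          using smax_ge[OF i] \<open>smax > 0\<close> by (intro mult_left_mono) auto
        then show "smax ^ k < \<epsilon> / s i"
          using Suc.prems(1) s_pos[OF i] by (simp add: field_simps)
        show "0 < \<epsilon> / s i"
          using Suc.prems s_pos[OF i] by simp
        \<comment> \<open>Since \<open>\<epsilon>\<close> is below 1 and \<open>smin\<close> is at
          most \<open>s i\<close>, the enlarged scale stays in the admissible range.\<close>
        have "\<epsilon> * smin \<le> 1 * s i"
          using False smin_le[OF i] smin_pos Suc.prems(2) by (intro mult_mono) auto
        then show "\<epsilon> / s i \<le> 1 / smin"
          using s_pos[OF i] smin_pos by (simp add: field_simps)
      qed
      then have "\<exists>\<Gamma>. \<forall>i\<in>{1..N}. is_cut (\<epsilon> / s i) (\<Gamma> i)"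
        by (intro bchoice) blast
      then show ?thesis
        using is_cut_prepend by blast
    qed
  qed
qed

text \<open>Each of the weights, which sum to 1, is at least
  \<open>(smin * \<epsilon>) powr d\<close>.\<close>

lemma cut_card_le:
  assumes "is_cut \<epsilon> \<Gamma>" "0 < \<epsilon>"
  shows "real (card \<Gamma>) * (smin * \<epsilon>) powr d \<le> 1"
proof -
  have "real (card \<Gamma>) * (smin * \<epsilon>) powr d = (\<Sum>w\<in>\<Gamma>. (smin * \<epsilon>) powr d)"
    by simp
  also have "\<dots> \<le> (\<Sum>w\<in>\<Gamma>. word_ratio s w powr d)"
    using assms smin_pos d_pos by (intro sum_mono powr_mono2) (auto simp: is_cut_def)
  also have "\<dots> = 1"
    using assms by (simp add: is_cut_def)
  finally show ?thesis .
qed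

section \<open>Bounded support of \<open>\<nu>\<close> and its covers by cut pieces\<close>

text \<open>Preimages of the complement of a large ball lie outside a still larger ball, so
  self-similarity bounds one tail of \<open>\<nu>\<close> by tails ever further out.\<close>

lemma bounded_support: "\<exists>R>0. measure \<nu> (- cball 0 R) = 0"
proof -
  define c where "c = (\<Sum>i=1..N. norm (f i 0))"
  \<comment> \<open>This radius solves \<open>smax * R0 + c = R0\<close>; an excess \<open>t\<close>
    of the norm over it becomes more than \<open>t / smax\<close> under preimages.\<close>
  define R0 where "R0 = c / (1 - smax)"
  define \<phi> where "\<phi> \<rho> = measure \<nu> (- cball 0 \<rho>)" for \<rho>
  have smax: "0 < smax"
    using smin_pos smin_le_smax by linarith
  have R0: "smax * R0 + c = R0" "0 \<le> R0"
    using smax_less_1 by (auto simp: R0_def c_def field_simps sum_nonneg)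
  have step: "\<phi> (R0 + t) \<le> \<phi> (R0 + t / smax)" for t
  proof -
    have "measure \<nu> (f i -` (- cball 0 (R0 + t))) \<le> \<phi> (R0 + t / smax)" if i: "i \<in> {1..N}" for i
      unfolding \<phi>_def
    proof (rule nu.finite_measure_mono)
      show "f i -` (- cball 0 (R0 + t)) \<subseteq> - cball 0 (R0 + t / smax)"
      proof
        fix x assume "x \<in> f i -` (- cball 0 (R0 + t))"
        then have "R0 + t < norm (f i x)" by simp
        also have "norm (f i x) \<le> norm (f i x - f i 0) + norm (f i 0)"
          by norm
        also have "norm (f i x - f i 0) = s i * norm x"
          using dist_f[OF i, of x 0] by (simp add: dist_norm)
        also have "s i * norm x \<le> smax * norm x"
          using smax_ge[OF i] by (intro mult_right_mono) auto
        also have "norm (f i 0) \<le> c"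
          unfolding c_def using i by (intro member_le_sum) auto
        finally have "smax * R0 + t < smax * norm x"
          using R0(1) by linarith
        then show "x \<in> - cball 0 (R0 + t / smax)"
          using smax by (simp add: field_simps)
      qed
    qed (simp add: sets_nu)
    then have "(\<Sum>i=1..N. s i powr d * measure \<nu> (f i -` (- cball 0 (R0 + t))))
      \<le> (\<Sum>i=1..N. s i powr d * \<phi> (R0 + t / smax))"
      by (intro sum_mono mult_left_mono) auto
    also have "\<dots> = \<phi> (R0 + t / smax)"
      using sum_ratio by (simp add: sum_distrib_right[symmetric])
    finally show ?thesis
      using measure_nu[of "- cball 0 (R0 + t)"] by (simp add: \<phi>_def)
  qed
  \<comment> \<open>Starting from excess 1, the radii on the right tend to infinity, where the tails
    vanish by continuity from above.\<close>
  have iter: "\<phi> (R0 + 1) \<le> \<phi> (R0 + (1 / smax) ^ k)" for k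
  proof (induction k)
    case (Suc k)
    then show ?case
      using step[of "(1 / smax) ^ k"] by simp
  qed simp
  have mono: "(1 / smax) ^ m \<le> (1 / smax) ^ n" if "m \<le> n" for m n
    using smax smax_less_1 that by (intro power_increasing) auto
  have "(\<lambda>k. \<phi> (R0 + (1 / smax) ^ k)) \<longlonglongrightarrow> measure \<nu> (\<Inter>k. - cball 0 (R0 + (1 / smax) ^ k))"
    unfolding \<phi>_def using mono
    by (intro nu.finite_Lim_measure_decseq) (force simp: sets_nu decseq_def)+
  also have "(\<Inter>k. - cball 0 (R0 + (1 / smax) ^ k)) = ({} :: (real^'q) set)"
  proof -
    have "\<exists>k. norm x \<le> R0 + (1 / smax) ^ k" for x :: "real^'q"
      using real_arch_pow[of "1 / smax" "norm x"] smax smax_less_1 R0(2)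
      by (auto intro: add_increasing less_imp_le)
    then show ?thesis
      by (intro equals0I) (metis ComplD INT_D UNIV_I mem_cball_0)
  qed
  finally have "(\<lambda>k. \<phi> (R0 + (1 / smax) ^ k)) \<longlonglongrightarrow> 0" by simp
  then have "\<phi> (R0 + 1) \<le> 0"
    using iter by (intro LIMSEQ_le_const) auto
  then have "measure \<nu> (- cball 0 (R0 + 1)) = 0"
    unfolding \<phi>_def by (simp add: measure_le_0_iff)
  then show ?thesis
    using R0(2) by (intro exI[of _ "R0 + 1"]) auto
qed

lemma cut_cover_closed:
  assumes "is_cut \<epsilon> \<Gamma>"
  shows "closed (\<Union>w\<in>\<Gamma>. word_map f w ` cball 0 R)"
  using assms word_continuous
  by (auto intro!: compact_imp_closed compact_UN compact_continuous_image simp: is_cut_def)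

text \<open>The cut identity writes this measure as a weighted sum over \<open>w\<close>; the piece
  of \<open>w\<close> belongs to the cover, so each preimage avoids
  \<open>cball 0 R\<close>.\<close>

lemma cut_cover_null:
  assumes cut: "is_cut \<epsilon> \<Gamma>" and R: "measure \<nu> (- cball 0 R) = 0"
  shows "measure \<nu> (- (\<Union>w\<in>\<Gamma>. word_map f w ` cball 0 R)) = 0"
proof -
  let ?A = "- (\<Union>w\<in>\<Gamma>. word_map f w ` cball 0 R)"
  have "?A \<in> sets borel"
    using cut_cover_closed[OF cut, of R] by (intro borel_open open_Compl)
  then have "measure \<nu> ?A = (\<Sum>w\<in>\<Gamma>. word_ratio s w powr d * measure \<nu> (word_map f w -` ?A))"
    using cut unfolding is_cut_def by blast
  moreover have "measure \<nu> (word_map f w -` ?A) = 0" if "w \<in> \<Gamma>" for w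
  proof -
    have "measure \<nu> (word_map f w -` ?A) \<le> measure \<nu> (- cball 0 R)"
      using that by (intro nu.finite_measure_mono) (auto simp: sets_nu)
    then show ?thesis
      using R by (simp add: measure_le_0_iff)
  qed
  ultimately show ?thesis
    by (simp del: vimage_Compl)
qed

section \<open>Measure of small balls under the open set condition\<close>

text \<open>Every cut piece meeting the ball contributes at most \<open>\<epsilon> powr d\<close>,
  and their number is bounded independently of \<open>x\<close> and \<open>\<epsilon>\<close>,
  because lengths in the volume comparison all scale with \<open>\<epsilon>\<close>.\<close>

lemma measure_ball_le:
  assumes "open_set_condition N f"
  obtains C where "1 \<le> C"
    "\<And>x \<epsilon>. 0 < \<epsilon> \<Longrightarrow> \<epsilon> \<le> 1 \<Longrightarrow> measure \<nu> (ball x \<epsilon>) \<le> C * \<epsilon> powr d"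
proof -
  obtain R where R: "0 < R" "measure \<nu> (- cball 0 R) = 0"
    using bounded_support by blast
  obtain U where U: "open U" "U \<noteq> {}" "\<forall>i\<in>{1..N}. f i ` U \<subseteq> U"
    "\<forall>i\<in>{1..N}. \<forall>j\<in>{1..N}. i \<noteq> j \<longrightarrow> f i ` U \<inter> f j ` U = {}"
    using assms unfolding open_set_condition_def by blast
  then obtain a \<rho> where a: "0 < \<rho>" "ball a \<rho> \<subseteq> U"
    by (meson openE ex_in_conv)
  \<comment> \<open>In units of \<open>\<epsilon>\<close>: 1 from \<open>x\<close> to a point of the
    piece, \<open>R + norm a\<close> on to the image of \<open>a\<close>, and \<open>\<rho>\<close>
    for the small ball around that image.\<close>
  define L where "L = 1 + R + norm a + \<rho>"
  \<comment> \<open>The maximum with 1 supplies \<open>1 \<le> C\<close>, used later to keep a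
    radius at most 1.\<close>
  define C where "C = max 1 ((L / (smin * \<rho>)) ^ DIM(real^'q))"
  have "measure \<nu> (ball x \<epsilon>) \<le> C * \<epsilon> powr d" if \<epsilon>: "0 < \<epsilon>" "\<epsilon> \<le> 1" for x \<epsilon>
  proof -
    have "1 \<le> 1 / smin"
      using smin_pos smin_le_smax smax_less_1 by simp
    then obtain \<Gamma> where cut: "is_cut \<epsilon> \<Gamma>"
      using is_cut_exists[of \<epsilon>] \<epsilon> by (meson order_trans)
    then have fin: "finite \<Gamma>"
      and words: "\<And>w. w \<in> \<Gamma> \<Longrightarrow> set w \<subseteq> {1..N}"
      and ratio: "\<And>w. w \<in> \<Gamma> \<Longrightarrow> smin * \<epsilon> \<le> word_ratio s w" "\<And>w. w \<in> \<Gamma> \<Longrightarrow> word_ratio s w \<le> \<epsilon>"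
      and meas: "measure \<nu> (ball x \<epsilon>) =
        (\<Sum>w\<in>\<Gamma>. word_ratio s w powr d * measure \<nu> (word_map f w -` ball x \<epsilon>))"
      and disj: "disjoint_family_on (\<lambda>w. word_map f w ` U) \<Gamma>"
      using U(3,4) unfolding is_cut_def by auto
    \<comment> \<open>Two sets act together: \<open>\<nu>\<close> lives on \<open>cball 0 R\<close>,
      which decides the pieces that count, while the images of \<open>U\<close> are the disjoint
      ones.\<close>
    define H where "H = {w \<in> \<Gamma>. word_map f w ` cball 0 R \<inter> ball x \<epsilon> \<noteq> {}}"
    have small: "ball (word_map f w a) (smin * \<epsilon> * \<rho>) \<subseteq> word_map f w ` U" if "w \<in> \<Gamma>" for w
    proof -
      have "ball (word_map f w a) (smin * \<epsilon> * \<rho>) \<subseteq> ball (word_map f w a) (word_ratio s w * \<rho>)"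
        using ratio(1)[OF that] a(1) by (intro subset_ball mult_right_mono) auto
      also have "\<dots> = word_map f w ` ball a \<rho>"
        using word_dist words[OF that] word_ratio_pos by (intro similitude_image_ball[symmetric]) auto
      finally show ?thesis
        using a(2) by blast
    qed
    have "real (card H) * (smin * \<epsilon> * \<rho>) ^ DIM(real^'q) \<le> (L * \<epsilon>) ^ DIM(real^'q)"
    proof (rule disjoint_balls_card_le)
      show "disjoint_family_on (\<lambda>w. ball (word_map f w a) (smin * \<epsilon> * \<rho>)) H"
        unfolding disjoint_family_on_def
      proof (intro ballI impI)
        fix u v assume uv: "u \<in> H" "v \<in> H" "u \<noteq> v"
        then have "u \<in> \<Gamma>" "v \<in> \<Gamma>"
          by (auto simp: H_def)
        then have "word_map f u ` U \<inter> word_map f v ` U = {}"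
          using disjoint_family_onD[OF disj] uv(3) by blast
        then show "ball (word_map f u a) (smin * \<epsilon> * \<rho>) \<inter> ball (word_map f v a) (smin * \<epsilon> * \<rho>) = {}"
          using small[OF \<open>u \<in> \<Gamma>\<close>] small[OF \<open>v \<in> \<Gamma>\<close>] by blast
      qed
      show "ball (word_map f w a) (smin * \<epsilon> * \<rho>) \<subseteq> ball x (L * \<epsilon>)" if "w \<in> H" for w
      proof
        fix z assume z: "z \<in> ball (word_map f w a) (smin * \<epsilon> * \<rho>)"
        have w: "w \<in> \<Gamma>" and "\<exists>y\<in>cball 0 R. word_map f w y \<in> ball x \<epsilon>"
          using that by (auto simp: H_def)
        then obtain y where y: "norm y \<le> R" "dist x (word_map f w y) < \<epsilon>"
          by auto
        have "dist (word_map f w y) (word_map f w a) = word_ratio s w * dist y a"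
          using word_dist words[OF w] by blast
        also have "\<dots> \<le> \<epsilon> * (R + norm a)"
          using ratio(2)[OF w] y(1) \<epsilon> norm_triangle_ineq4[of y a]
          by (intro mult_mono) (auto simp: dist_norm)
        finally have "dist x (word_map f w a) < \<epsilon> + \<epsilon> * (R + norm a)"
          using y(2) dist_triangle[of x "word_map f w a" "word_map f w y"] by linarith
        moreover have "dist (word_map f w a) z < 1 * \<epsilon> * \<rho>"
        proof -
          have "smin * \<epsilon> * \<rho> \<le> 1 * \<epsilon> * \<rho>"
            using smin_le_smax smax_less_1 \<epsilon> a(1) by (intro mult_right_mono) auto
          then show ?thesis using z by simp
        qed
        ultimately have "dist x z < \<epsilon> + \<epsilon> * (R + norm a) + \<epsilon> * \<rho>"
          using dist_triangle[of x z "word_map f w a"] by simp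
        then show "z \<in> ball x (L * \<epsilon>)"
          by (simp add: L_def algebra_simps)
      qed
    qed (use fin smin_pos \<epsilon> a(1) R in \<open>auto simp: H_def L_def\<close>)
    then have "real (card H) \<le> (L * \<epsilon> / (smin * \<epsilon> * \<rho>)) ^ DIM(real^'q)"
      using smin_pos \<epsilon> a(1) unfolding power_divide by (subst pos_le_divide_eq) auto
    also have "L * \<epsilon> / (smin * \<epsilon> * \<rho>) = L / (smin * \<rho>)"
      using \<epsilon> by simp
    finally have card: "real (card H) \<le> C"
      by (simp add: C_def)
    have "word_ratio s w powr d * measure \<nu> (word_map f w -` ball x \<epsilon>)
        \<le> (if w \<in> H then \<epsilon> powr d else 0)" if w: "w \<in> \<Gamma>" for w
    proof (cases "w \<in> H")
      case True
      have "word_ratio s w powr d * measure \<nu> (word_map f w -` ball x \<epsilon>) \<le> \<epsilon> powr d * 1"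
        using ratio(2)[OF w] word_ratio_pos[OF words[OF w]] d_pos
        by (intro mult_mono powr_mono2) auto
      then show ?thesis using True by simp
    next
      case False
      \<comment> \<open>The piece of \<open>w\<close> misses the ball, so the preimage of the ball
        lies outside \<open>cball 0 R\<close>.\<close>
      then have "measure \<nu> (word_map f w -` ball x \<epsilon>) \<le> measure \<nu> (- cball 0 R)"
        using w by (intro nu.finite_measure_mono) (auto simp: sets_nu H_def)
      then show ?thesis
        using False R(2) by (simp add: measure_le_0_iff)
    qed
    then have "measure \<nu> (ball x \<epsilon>) \<le> (\<Sum>w\<in>\<Gamma>. if w \<in> H then \<epsilon> powr d else 0)"
      unfolding meas by (intro sum_mono)
    also have "\<dots> = real (card H) * \<epsilon> powr d"
      using fin by (simp add: sum.If_cases H_def Int_def)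
    also have "\<dots> \<le> C * \<epsilon> powr d"
      using card by (intro mult_right_mono) auto
    finally show ?thesis .
  qed
  then show thesis
    using that[of C] by (simp add: C_def)
qed

section \<open>Null sets of the condensation measure\<close>

text \<open>This lets the closed cover built for \<open>\<nu>\<close> carry \<open>\<mu>\<close> as
  well, so that one set of centres serves both measures.\<close>

lemma condensation_null:
  assumes \<mu>: "condensation_measure N f p \<nu> \<mu>"
    and p: "\<And>i. i \<in> {1..N} \<Longrightarrow> 0 \<le> p i" "(\<Sum>i=1..N. p i) < 1"
    and A: "closed A" "measure \<nu> (- A) = 0"
  shows "emeasure \<mu> (- A) = 0"
proof -
  define V where "V = \<Union>{W. open W \<and> W \<in> null_sets \<nu>}"
  interpret mu: prob_space \<mu>
    using \<mu> by (simp add: condensation_measure_def borel_prob_measure_def)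
  have sets_mu: "sets \<mu> = sets borel"
    using \<mu> by (simp add: condensation_measure_def borel_prob_measure_def)
  then have space_mu: "space \<mu> = UNIV"
    using sets_eq_imp_space_eq[of \<mu> borel] by simp
  have "open V"
    unfolding V_def by (rule open_Union) auto
  have V_null: "emeasure \<nu> V = 0"
    using Union_open_null_sets[OF sets_nu] unfolding V_def by blast
  \<comment> \<open>All terms of the self-similarity sum for the null set \<open>V\<close> vanish
    and the weights are positive, so the preimage is an open null set and thus contained in
    \<open>V\<close>.\<close>
  have sub: "f i -` V \<subseteq> V" if i: "i \<in> {1..N}" for i
  proof -
    have op: "open (f i -` V)"
      using contractive_similitude_continuous[OF similitude[OF i], of UNIV] \<open>open V\<close>
      by (simp add: open_vimage)
    have "(\<Sum>j=1..N. s j powr d * measure \<nu> (f j -` V)) = 0"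
      using measure_nu[of V] \<open>open V\<close> V_null by (simp add: measure_def)
    then have "s i powr d * measure \<nu> (f i -` V) = 0"
      using i by (subst (asm) sum_nonneg_eq_0_iff) auto
    then have "measure \<nu> (f i -` V) = 0"
      using s_pos[OF i] by simp
    then have "f i -` V \<in> null_sets \<nu>"
      using op by (intro null_setsI) (auto simp: sets_nu nu.emeasure_eq_measure)
    then show ?thesis
      using op unfolding V_def by blast
  qed
  have "emeasure \<mu> V = ennreal (p 0) * emeasure \<nu> V +
      (\<Sum>i=1..N. ennreal (p i) * emeasure (distr \<mu> borel (f i)) V)"
    using \<mu> \<open>open V\<close> by (auto simp: condensation_measure_def)
  also have "\<dots> = (\<Sum>i=1..N. ennreal (p i) * emeasure (distr \<mu> borel (f i)) V)"
    by (simp add: V_null)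
  also have "\<dots> \<le> (\<Sum>i=1..N. ennreal (p i) * emeasure \<mu> V)"
  proof (intro sum_mono mult_left_mono)
    fix i assume i: "i \<in> {1..N}"
    have "emeasure (distr \<mu> borel (f i)) V = emeasure \<mu> (f i -` V)"
      using f_measurable[OF i] \<open>open V\<close>
      by (subst emeasure_distr) (auto simp: space_mu sets_mu cong: measurable_cong_sets)
    also have "\<dots> \<le> emeasure \<mu> V"
      using sub[OF i] \<open>open V\<close> by (intro emeasure_mono) (auto simp: sets_mu)
    finally show "emeasure (distr \<mu> borel (f i)) V \<le> emeasure \<mu> V" .
  qed simp
  also have "\<dots> = ennreal ((\<Sum>i=1..N. p i) * measure \<mu> V)"
    unfolding sum_distrib_right mu.emeasure_eq_measure using p(1)
    by (subst sum_ennreal[symmetric]) (auto simp: ennreal_mult intro!: sum.cong)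
  \<comment> \<open>The factor is below 1, which leaves only the value 0.\<close>
  finally have "measure \<mu> V \<le> (\<Sum>i=1..N. p i) * measure \<mu> V"
    unfolding mu.emeasure_eq_measure using p(1)
    by (subst (asm) ennreal_le_iff) (auto intro!: mult_nonneg_nonneg sum_nonneg)
  then have "(1 - (\<Sum>i=1..N. p i)) * measure \<mu> V \<le> 0"
    by (simp add: algebra_simps)
  then have "measure \<mu> V = 0"
    using p(2) by (simp add: mult_le_0_iff measure_le_0_iff)
  moreover have "- A \<subseteq> V"
  proof -
    have "- A \<in> null_sets \<nu>"
      using A by (intro null_setsI) (auto simp: sets_nu nu.emeasure_eq_measure)
    then show ?thesis
      using A(1) unfolding V_def by blast
  qed
  then have "emeasure \<mu> (- A) \<le> emeasure \<mu> V"
    using \<open>open V\<close> by (intro emeasure_mono) (auto simp: sets_mu)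
  ultimately show ?thesis
    by (simp add: mu.emeasure_eq_measure)
qed

section \<open>Upper and lower bounds for the quantization error\<close>

text \<open>The images of 0 under the words of a cut are the centres. The resulting distance bound
  holds almost everywhere, so the constant \<open>R / smin\<close> is the same for all
  \<open>r\<close>.\<close>

lemma quantization_error_upper:
  assumes \<mu>: "condensation_measure N f p \<nu> \<mu>"
    and p: "\<And>i. i \<in> {1..N} \<Longrightarrow> 0 \<le> p i" "(\<Sum>i=1..N. p i) < 1"
    and "0 < r"
  obtains C where "\<And>n. 1 \<le> n \<Longrightarrow> quantization_error n r \<mu> \<le> ennreal (C * real n powr (- 1 / d))"
proof -
  obtain R where R: "0 < R" "measure \<nu> (- cball 0 R) = 0"
    using bounded_support by blast
  interpret mu: prob_space \<mu>
    using \<mu> by (simp add: condensation_measure_def borel_prob_measure_def)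
  have sets_mu: "sets \<mu> = sets borel"
    using \<mu> by (simp add: condensation_measure_def borel_prob_measure_def)
  have "quantization_error n r \<mu> \<le> ennreal (R / smin * real n powr (- 1 / d))" if n: "1 \<le> n" for n
  proof -
    \<comment> \<open>Chosen so that \<open>(smin * \<epsilon>) powr d = 1 / real n\<close>, which
      makes the cut have at most \<open>n\<close> words.\<close>
    define \<epsilon> where "\<epsilon> = real n powr (- 1 / d) / smin"
    have \<epsilon>: "0 < \<epsilon>"
      using n smin_pos by (simp add: \<epsilon>_def)
    have "real n powr (- 1 / d) \<le> 1"
      using n d_pos powr_mono[of "- 1 / d" 0 "real n"] by simp
    then have "\<epsilon> \<le> 1 / smin"
      using smin_pos by (simp add: \<epsilon>_def divide_right_mono)
    then obtain \<Gamma> where cut: "is_cut \<epsilon> \<Gamma>"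
      using is_cut_exists \<epsilon> by blast
    have fin: "finite \<Gamma>" and "\<Gamma> \<noteq> {}"
      and words: "\<And>w. w \<in> \<Gamma> \<Longrightarrow> set w \<subseteq> {1..N} \<and> word_ratio s w \<le> \<epsilon>"
      using cut unfolding is_cut_def by auto
    define \<alpha> where "\<alpha> = (\<lambda>w. word_map f w 0) ` \<Gamma>"
    have "(smin * \<epsilon>) powr d = real n powr (- 1)"
      using smin_pos d_pos by (simp add: \<epsilon>_def powr_powr)
    then have \<epsilon>_powr: "(smin * \<epsilon>) powr d = 1 / real n"
      by (simp add: powr_minus_divide)
    then have "card \<Gamma> \<le> n"
      using cut_card_le[OF cut \<epsilon>] n unfolding \<epsilon>_powr by (simp add: field_simps)
    then have \<alpha>: "finite \<alpha>" "1 \<le> card \<alpha>" "card \<alpha> \<le> n"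
      using fin \<open>\<Gamma> \<noteq> {}\<close> card_image_le[OF fin, of "\<lambda>w. word_map f w 0"]
      by (auto simp: \<alpha>_def Suc_le_eq card_gt_0_iff)
    let ?A = "\<Union>w\<in>\<Gamma>. word_map f w ` cball 0 R"
    have "emeasure \<mu> (- ?A) = 0"
      by (rule condensation_null[OF \<mu> p cut_cover_closed[OF cut] cut_cover_null[OF cut R(2)]])
    then have "AE x in \<mu>. x \<in> ?A"
      using borel_open[OF open_Compl[OF cut_cover_closed[OF cut, of R]]]
      by (intro AE_I'[of "- ?A"] null_setsI) (auto simp only: sets_mu)
    moreover have "infdist x \<alpha> powr r \<le> (\<epsilon> * R) powr r" if x: "x \<in> ?A" for x
    proof -
      obtain w y where w: "w \<in> \<Gamma>" "norm y \<le> R" "x = word_map f w y"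
        using x by auto
      have "infdist x \<alpha> \<le> dist x (word_map f w 0)"
        using w by (intro infdist_le) (auto simp: \<alpha>_def)
      also have "\<dots> = word_ratio s w * norm y"
        using word_dist[of w y 0] words[OF w(1)] w(3) by simp
      also have "\<dots> \<le> \<epsilon> * R"
        using words[OF w(1)] w(2) \<epsilon> by (intro mult_mono) auto
      finally show ?thesis
        using \<open>0 < r\<close> by (intro powr_mono2) (auto simp: infdist_nonneg)
    qed
    ultimately have "(\<integral>\<^sup>+x. ennreal (infdist x \<alpha> powr r) \<partial>\<mu>) \<le> (\<integral>\<^sup>+x. ennreal ((\<epsilon> * R) powr r) \<partial>\<mu>)"
      by (intro nn_integral_mono_AE) (auto intro: ennreal_leI)
    then have "(\<integral>\<^sup>+x. ennreal (infdist x \<alpha> powr r) \<partial>\<mu>) \<le> ennreal ((\<epsilon> * R) powr r)"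
      by (simp add: mu.emeasure_space_1)
    then have "ennpowr (\<integral>\<^sup>+x. ennreal (infdist x \<alpha> powr r) \<partial>\<mu>) (1 / r)
        \<le> ennpowr (ennreal ((\<epsilon> * R) powr r)) (1 / r)"
      using \<open>0 < r\<close> by (intro ennpowr_mono) auto
    also have "\<dots> = ennreal (\<epsilon> * R)"
      using \<epsilon> R \<open>0 < r\<close> by (simp add: ennpowr_def powr_powr)
    also have "\<epsilon> * R = R / smin * real n powr (- 1 / d)"
      by (simp add: \<epsilon>_def)
    finally show ?thesis
      unfolding quantization_error_def using \<alpha> by (intro INF_lower2[of \<alpha>]) auto
  qed
  then show thesis
    using that by blast
qed

text \<open>Points at distance at least \<open>\<epsilon>\<close> from the centres keep half of the
  mass of \<open>\<nu>\<close>, hence mass \<open>p / 2\<close> for \<open>\<mu>\<close>, and there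
  the integrand is at least \<open>\<epsilon> powr r\<close>.\<close>

lemma quantization_error_lower:
  assumes osc: "open_set_condition N f"
    and \<mu>: "borel_prob_measure \<mu>"
    and p: "0 < p" "\<And>A. A \<in> sets borel \<Longrightarrow> p * measure \<nu> A \<le> measure \<mu> A"
    and "0 < r"
  obtains c where "0 < c" "\<And>n. 1 \<le> n \<Longrightarrow> ennreal (c * real n powr (- 1 / d)) \<le> quantization_error n r \<mu>"
proof -
  obtain C where C: "1 \<le> C"
    "\<And>x \<epsilon>. 0 < \<epsilon> \<Longrightarrow> \<epsilon> \<le> 1 \<Longrightarrow> measure \<nu> (ball x \<epsilon>) \<le> C * \<epsilon> powr d"
    using measure_ball_le[OF osc] by blast
  interpret mu: prob_space \<mu>
    using \<mu> by (simp add: borel_prob_measure_def)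
  have sets_mu: "sets \<mu> = sets borel"
    using \<mu> by (simp add: borel_prob_measure_def)
  \<comment> \<open>The final bound is \<open>\<epsilon> * (p / 2) powr (1 / r)\<close>; this is its
    factor independent of \<open>n\<close>.\<close>
  define c where "c = (2 * C) powr (- 1 / d) * (p / 2) powr (1 / r)"
  have "ennreal (c * real n powr (- 1 / d)) \<le> quantization_error n r \<mu>" if n: "1 \<le> n" for n
    unfolding quantization_error_def
  proof (rule INF_greatest)
    fix \<alpha> :: "(real^'q) set"
    assume "\<alpha> \<in> {\<alpha>. finite \<alpha> \<and> 1 \<le> card \<alpha> \<and> card \<alpha> \<le> n}"
    then have \<alpha>: "finite \<alpha>" "\<alpha> \<noteq> {}" "card \<alpha> \<le> n"
      by auto
    \<comment> \<open>Solves \<open>real n * (C * \<epsilon> powr d) = 1 / 2\<close>, so that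
      \<open>n\<close> balls of this radius carry at most half of the mass of
      \<open>\<nu>\<close>.\<close>
    define \<epsilon> where "\<epsilon> = (2 * C * real n) powr (- 1 / d)"
    \<comment> \<open>Ensures \<open>\<epsilon> \<le> 1\<close>, the range in which the ball
      estimate holds.\<close>
    have Cn: "1 \<le> C * real n"
      using mult_mono[of 1 C 1 "real n"] C(1) n by simp
    then have \<epsilon>: "0 < \<epsilon>" "\<epsilon> \<le> 1"
      using C(1) n d_pos powr_mono[of "- 1 / d" 0 "2 * C * real n"] by (auto simp: \<epsilon>_def)
    have "\<epsilon> powr d = (2 * C * real n) powr (- 1)"
      using d_pos by (simp add: \<epsilon>_def powr_powr)
    then have \<epsilon>_powr: "\<epsilon> powr d = 1 / (2 * C * real n)"
      using C(1) by (simp add: powr_minus_divide)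
    define A where "A = {x. \<epsilon> \<le> infdist x \<alpha>}"
    have "closed A"
      unfolding A_def by (intro closed_Collect_le continuous_intros)
    have "- A \<subseteq> (\<Union>a\<in>\<alpha>. ball a \<epsilon>)"
    proof
      fix x assume "x \<in> - A"
      moreover obtain a where "a \<in> \<alpha>" "infdist x \<alpha> = dist x a"
        using infdist_attains_inf[of \<alpha> x] \<alpha> finite_imp_closed by blast
      ultimately show "x \<in> (\<Union>a\<in>\<alpha>. ball a \<epsilon>)"
        by (auto simp: A_def dist_commute not_le)
    qed
    then have "measure \<nu> (- A) \<le> measure \<nu> (\<Union>a\<in>\<alpha>. ball a \<epsilon>)"
      using \<alpha>(1) by (intro nu.finite_measure_mono) (auto simp: sets_nu)
    also have "\<dots> \<le> (\<Sum>a\<in>\<alpha>. measure \<nu> (ball a \<epsilon>))"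
      using \<alpha>(1) by (intro measure_UNION_le) (auto simp: sets_nu)
    also have "\<dots> \<le> (\<Sum>a\<in>\<alpha>. C * \<epsilon> powr d)"
      using C(2) \<epsilon> by (intro sum_mono) auto
    also have "\<dots> = real (card \<alpha>) * (C * \<epsilon> powr d)"
      by simp
    also have "\<dots> \<le> real n * (C * \<epsilon> powr d)"
      using \<alpha>(3) C(1) by (intro mult_right_mono) auto
    also have "\<dots> = 1 / 2"
      using C(1) n by (simp add: \<epsilon>_powr)
    finally have "1 / 2 \<le> measure \<nu> A"
      using nu.prob_compl[of A] \<open>closed A\<close> by (simp add: sets_nu space_nu Compl_eq_Diff_UNIV)
    then have "p / 2 \<le> p * measure \<nu> A"
      using p(1) by simp
    also have "\<dots> \<le> measure \<mu> A"
      using p(2) \<open>closed A\<close> by simp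
    finally have A: "p / 2 \<le> measure \<mu> A" .
    have "\<epsilon> powr r * (p / 2) \<le> \<epsilon> powr r * measure \<mu> A"
      by (intro mult_left_mono A) auto
    then have "ennreal (\<epsilon> powr r * (p / 2)) \<le> ennreal (\<epsilon> powr r) * emeasure \<mu> A"
      by (simp only: mu.emeasure_eq_measure ennreal_mult'[symmetric] powr_ge_zero ennreal_leI)
    also have "\<dots> = (\<integral>\<^sup>+x. ennreal (\<epsilon> powr r) * indicator A x \<partial>\<mu>)"
      using \<open>closed A\<close> by (simp add: nn_integral_cmult_indicator sets_mu)
    also have "\<dots> \<le> (\<integral>\<^sup>+x. ennreal (infdist x \<alpha> powr r) \<partial>\<mu>)"
      using \<epsilon> \<open>0 < r\<close>
      by (intro nn_integral_mono) (auto simp: A_def indicator_def intro!: ennreal_leI powr_mono2)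
    finally have "ennpowr (ennreal (\<epsilon> powr r * (p / 2))) (1 / r)
        \<le> ennpowr (\<integral>\<^sup>+x. ennreal (infdist x \<alpha> powr r) \<partial>\<mu>) (1 / r)"
      using \<open>0 < r\<close> by (intro ennpowr_mono) auto
    moreover have "ennpowr (ennreal (\<epsilon> powr r * (p / 2))) (1 / r) = ennreal (\<epsilon> * (p / 2) powr (1 / r))"
      using \<epsilon> p(1) \<open>0 < r\<close> powr_mult[of "\<epsilon> powr r" "p / 2" "1 / r"]
      by (simp add: ennpowr_def powr_powr)
    moreover have "\<epsilon> * (p / 2) powr (1 / r) = c * real n powr (- 1 / d)"
      using C(1) by (simp add: \<epsilon>_def c_def powr_mult)
    ultimately show "ennreal (c * real n powr (- 1 / d))
        \<le> ennpowr (\<integral>\<^sup>+x. ennreal (infdist x \<alpha> powr r) \<partial>\<mu>) (1 / r)"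
      by simp
  qed
  then show thesis
    using that[of c] C(1) p(1) by (simp add: c_def)
qed

end

theorem corollary1p3:
  fixes N :: nat
    and f :: "nat \<Rightarrow> real^'q \<Rightarrow> real^'q"
    and s p :: "nat \<Rightarrow> real"
    and d0 :: real
    and \<nu> \<mu> :: "(real^'q) measure"
  assumes "N \<ge> 2"
    and "\<And>i. i \<in> {1..N} \<Longrightarrow> contractive_similitude (s i) (f i)"
    and "open_set_condition N f"
    and "d0 > 0" and "(\<Sum>i=1..N. s i powr d0) = 1"
    and "self_similar_measure N f (\<lambda>i. s i powr d0) \<nu>"
    and "\<And>i. i \<in> {0..N} \<Longrightarrow> p i > 0" and "(\<Sum>i=0..N. p i) = 1"
    and "condensation_measure N f p \<nu> \<mu>"
  shows "\<forall>r>0. has_quantization_dim r \<mu> (ereal d0) \<and>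
      0 < lower_quantization_coeff r d0 \<mu> \<and>
      lower_quantization_coeff r d0 \<mu> \<le> upper_quantization_coeff r d0 \<mu> \<and>
      upper_quantization_coeff r d0 \<mu> < \<infinity>"
proof (intro allI impI)
  fix r :: real assume "0 < r"
  interpret natural_self_similar N f s d0 \<nu>
    by (rule natural_self_similar.intro) (fact assms)+
  have split: "(\<Sum>i=0..N. p i) = p 0 + (\<Sum>i=1..N. p i)"
    by (simp add: sum.atLeast_Suc_atMost)
  have "0 < p 0"
    by (rule assms(7)) simp
  moreover have "0 \<le> p i" if "i \<in> {1..N}" for i
    using assms(7)[of i] that by simp
  \<comment> \<open>Positivity of \<open>p 0\<close> acts twice: it puts the remaining weights below
    1 for the upper bound, and it gives the domination of \<open>\<nu>\<close> for the lower
    bound.\<close>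
  ultimately have p: "\<And>i. i \<in> {1..N} \<Longrightarrow> 0 \<le> p i" "(\<Sum>i=1..N. p i) < 1" "0 < p 0"
    using assms(8) split by simp_all
  have \<mu>: "borel_prob_measure \<mu>"
    using assms(9) by (simp add: condensation_measure_def)
  interpret mu: prob_space \<mu>
    using \<mu> by (simp add: borel_prob_measure_def)
  \<comment> \<open>Dropping the nonnegative image terms from the equation for \<open>\<mu>\<close>
    leaves this inequality.\<close>
  have dom: "p 0 * measure \<nu> A \<le> measure \<mu> A" if "A \<in> sets borel" for A
  proof -
    have "ennreal (p 0) * emeasure \<nu> A \<le> emeasure \<mu> A"
      using assms(9) that by (simp add: condensation_measure_def)
    then show ?thesis
      using p(3) by (simp add: mu.emeasure_eq_measure nu.emeasure_eq_measure ennreal_mult[symmetric])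
  qed
  obtain c where c: "0 < c"
    "\<And>n. 1 \<le> n \<Longrightarrow> ennreal (c * real n powr (- 1 / d0)) \<le> quantization_error n r \<mu>"
    by (rule quantization_error_lower[OF assms(3) \<mu> p(3) dom \<open>0 < r\<close>], assumption) (rule that)
  obtain C where C:
    "\<And>n. 1 \<le> n \<Longrightarrow> quantization_error n r \<mu> \<le> ennreal (C * real n powr (- 1 / d0))"
    by (rule quantization_error_upper[OF assms(9) p(1,2) \<open>0 < r\<close>], assumption) (rule that)
  show "has_quantization_dim r \<mu> (ereal d0) \<and>
      0 < lower_quantization_coeff r d0 \<mu> \<and>
      lower_quantization_coeff r d0 \<mu> \<le> upper_quantization_coeff r d0 \<mu> \<and>
      upper_quantization_coeff r d0 \<mu> < \<infinity>"
    by (rule conjI[OF has_quantization_dim_of_bounds[OF \<open>d0 > 0\<close> c C]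
      quantization_coeff_of_bounds[OF c C]])
qed

end
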